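(* Let $r,k\ge 1$ be integers and let $\Lambda_{rk}=\{(n,i,j)\in\mathbb Z^3:\ 1\le i\le r,\ 1\le j\le k\}$. Let $Y:\Lambda_{rk}\to\mathbb C^*$ be a solution of the truncated $Y$-system, i.e. for every $(n,i,j)\in\Lambda_{rk}$ $$Y(n-1,i,j)\,Y(n+1,i,j)=\frac{\bigl(1+Y(n,i-1,j)\bigr)\bigl(1+Y(n,i+1,j)\bigr)}{\bigl(1+1/Y(n,i,j+1)\bigr)\bigl(1+1/Y(n,i,j-1)\bigr)},$$ where every factor on the right-hand side that involves a site outside $\Lambda_{rk}$ is omitted (replaced by $1$). Then for all $(n,i,j)\in\Lambda_{rk}$ $$Y(n,i,j)=Y(n+r+k+2,\ r+1-i,\ k+1-j).$$
   Context: $\mathbb C^*=\mathbb C\setminus\{0\}$. The omission convention: the factor $1+Y(n,i-1,j)$ is omitted when $i=1$, the factor $1+Y(n,i+1,j)$ is omitted when $i=r$, the factor $1+1/Y(n,i,j+1)$ is omitted when $j=k$, and the factor $1+1/Y(n,i,j-1)$ is omitted when $j=1$. That $Y$ satisfies the equations includes the requirement that they make sense, i.e. that no (non-omitted) denominator factor vanishes. *)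

theory Defs
  imports Complex_Main
begin

definition Lam :: "int \<Rightarrow> int \<Rightarrow> (int \<times> int \<times> int) set" where
  "Lam r k = {(n, i, j). 1 \<le> i \<and> i \<le> r \<and> 1 \<le> j \<and> j \<le> k}"

(* Omission convention: a factor belonging to a site outside the lattice is replaced by 1. *)

definition num_factor ::
  "int \<Rightarrow> int \<Rightarrow> (int \<times> int \<times> int \<Rightarrow> complex) \<Rightarrow> int \<times> int \<times> int \<Rightarrow> complex" where
  "num_factor r k Y s = (if s \<in> Lam r k then 1 + Y s else 1)"

definition den_factor ::
  "int \<Rightarrow> int \<Rightarrow> (int \<times> int \<times> int \<Rightarrow> complex) \<Rightarrow> int \<times> int \<times> int \<Rightarrow> complex" where
  "den_factor r k Y s = (if s \<in> Lam r k then 1 + 1 / Y s else 1)"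

(* Y is a total function, but only its values on Lam r k are constrained or used. Division in HOL
   is total, so the requirement that the equations make sense is stated explicitly, as the
   non-vanishing of the denominator factors. *)

definition truncated_Y_system ::
  "int \<Rightarrow> int \<Rightarrow> (int \<times> int \<times> int \<Rightarrow> complex) \<Rightarrow> bool" where
  "truncated_Y_system r k Y \<longleftrightarrow>
     (\<forall>n i j. (n, i, j) \<in> Lam r k \<longrightarrow>
        den_factor r k Y (n, i, j + 1) \<noteq> 0 \<and>
        den_factor r k Y (n, i, j - 1) \<noteq> 0 \<and>
        Y (n - 1, i, j) * Y (n + 1, i, j) =
          (num_factor r k Y (n, i - 1, j) * num_factor r k Y (n, i + 1, j)) /
          (den_factor r k Y (n, i, j + 1) * den_factor r k Y (n, i, j - 1)))"

end

theory Submission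
  imports Defs "Jordan_Normal_Form.Determinant"
begin

text \<open>
  Put \<open>d = r + 1\<close> and \<open>N = r + k + 2\<close>. For a sequence of vectors \<open>v\<^sub>a\<close> in a \<open>d\<close>-dimensional space let
  \<open>D(a, i, j)\<close> be the determinant of \<open>i\<close> consecutive vectors starting at \<open>v\<^sub>a\<close> followed, after a
  gap of \<open>j\<close> vectors, by \<open>d - i\<close> consecutive ones. The three-term Pluecker relation makes \<open>D\<close> a
  solution of the octahedron recurrence, so that
  \<open>1 + y(a, i, j) = D(a, i, j) D(a + 1, i, j) / (D(a + 1, i, j - 1) D(a, i, j + 1))\<close> solves the
  \<open>Y\<close>-system, where \<open>y(a, i, j)\<close> stands for \<open>Y(2 a + i + j + const, i, j)\<close>. Conversely, a solution
  \<open>Y\<close> without the value \<open>-1\<close> arises in this way: the values at \<open>j = 1\<close> determine the coefficients of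
  a linear recurrence for \<open>v\<close>, and induction on the gap extends the formula to all \<open>j \<le> k\<close>.
  The boundary at \<open>j = k\<close> then says \<open>D(a, i, k + 1) \<noteq> 0\<close> and \<open>D(a, i, k + 2) = 0\<close> for
  \<open>0 < i < d\<close>, which forces \<open>v\<^sub>a\<^sub>+\<^sub>N\<close> to be a multiple of \<open>v\<^sub>a\<close>. Exchanging the two blocks of vectors
  hence changes \<open>D\<close> only by factors that cancel in the formula for \<open>1 + y\<close>, and it replaces
  \<open>(i, j)\<close> by \<open>(r + 1 - i, k + 1 - j)\<close>. The value \<open>-1\<close> can occur only for \<open>r = k = 1\<close>.
\<close>

section \<open>Determinants as functions of their rows\<close>

text \<open>Taking the rows as plain functions lets row exchanges and replacements be written as
  reindexing and function update; entries beyond the first \<open>d\<close> are ignored.\<close>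

definition rdet :: "nat \<Rightarrow> (nat \<Rightarrow> nat \<Rightarrow> 'a) \<Rightarrow> 'a :: comm_ring_1" where
  "rdet d f = det (mat d d (\<lambda>(i, j). f i j))"

lemma rdet_cong:
  assumes "\<And>c. c < d \<Longrightarrow> f c = g c"
  shows "rdet d f = rdet d g"
  unfolding rdet_def by (rule arg_cong[where f = det]) (auto simp: assms)

lemma rdet_unit_vectors: "rdet d (\<lambda>i j. if i = j then 1 else 0) = 1"
proof -
  have "mat d d (\<lambda>(i, j). if i = j then 1 else 0) = (1\<^sub>m d :: 'a mat)"
    by auto
  then show ?thesis
    by (simp add: rdet_def)
qed

lemma rdet_swap:
  assumes "a < d" "b < d" "a \<noteq> b"
  shows "rdet d (\<lambda>c. f (transpose a b c)) = - rdet d f"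
proof -
  let ?A = "mat d d (\<lambda>(i, j). f i j)"
  have p: "transpose a b permutes {0..<d}"
    using assms by (intro permutes_swap_id) auto
  have "rdet d (\<lambda>c. f (transpose a b c)) = det (mat d d (\<lambda>(i, j). ?A $$ (transpose a b i, j)))"
    unfolding rdet_def
    by (rule arg_cong[where f = det]) (use assms in \<open>auto simp: transpose_def\<close>)
  also have "\<dots> = signof (transpose a b) * det ?A"
    by (rule det_permute_rows[OF _ p]) auto
  finally show ?thesis
    using assms by (simp add: rdet_def sign_swap_id)
qed

text \<open>The cycle that brings row \<open>m\<close> to the top is a product of \<open>m\<close>
  adjacent transpositions, peeled off one by one.\<close>

lemma rdet_move:
  assumes "m < d"
  shows "rdet d (\<lambda>c. if c = 0 then f m else if c \<le> m then f (c - 1) else f c) = (-1) ^ m * rdet d f"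
  using assms
proof (induction m arbitrary: f)
  case 0
  have "rdet d (\<lambda>c. if c = 0 then f 0 else if c \<le> 0 then f (c - 1) else f c) = rdet d f"
    by (rule rdet_cong) auto
  then show ?case
    by simp
next
  case (Suc m)
  let ?g = "\<lambda>c. f (transpose m (Suc m) c)"
  have "rdet d (\<lambda>c. if c = 0 then f (Suc m) else if c \<le> Suc m then f (c - 1) else f c)
      = rdet d (\<lambda>c. if c = 0 then ?g m else if c \<le> m then ?g (c - 1) else ?g c)"
    by (rule rdet_cong) (auto simp: transpose_def)
  also have "\<dots> = (-1) ^ m * rdet d ?g"
    using Suc by simp
  also have "rdet d ?g = - rdet d f"
    using Suc.prems by (intro rdet_swap) auto
  finally show ?case
    by simp
qed

lemma rdet_identical:
  assumes "a < d" "b < d" "a \<noteq> b" "f a = f b"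
  shows "rdet d f = 0"
  unfolding rdet_def
  by (rule det_identical_rows[of _ d a b]) (use assms in \<open>auto simp: row_def\<close>)

text \<open>Laplace expansion along row 0, whose cofactors do not involve that row.\<close>

lemma rdet_linear:
  fixes f :: "nat \<Rightarrow> nat \<Rightarrow> 'a :: comm_ring_1"
  assumes "0 < d" "finite S" and x: "\<And>j. j < d \<Longrightarrow> f 0 j = (\<Sum>s\<in>S. x s * g s j)"
  shows "rdet d f = (\<Sum>s\<in>S. x s * rdet d (f(0 := g s)))"
proof -
  let ?M = "\<lambda>f :: nat \<Rightarrow> nat \<Rightarrow> 'a. mat d d (\<lambda>(i, j). f i j)"
  have exp: "rdet d h = (\<Sum>j<d. h 0 j * cofactor (?M h) 0 j)" for h
    unfolding rdet_def using assms(1) by (subst laplace_expansion_row[of _ d 0]) auto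
  have upd: "rdet d (f(0 := h)) = (\<Sum>j<d. h j * cofactor (?M f) 0 j)" for h
  proof -
    have "cofactor (?M (f(0 := h))) 0 j = cofactor (?M f) 0 j" for j
      unfolding cofactor_def mat_delete_def
      by (intro arg_cong2[where f = "(*)"] arg_cong[where f = det] refl eq_matI) auto
    then show ?thesis
      unfolding exp by (simp only: fun_upd_same)
  qed
  have "rdet d f = (\<Sum>j<d. \<Sum>s\<in>S. x s * (g s j * cofactor (?M f) 0 j))"
    unfolding exp[of f] by (intro sum.cong refl) (simp add: x sum_distrib_right mult.assoc)
  also have "\<dots> = (\<Sum>s\<in>S. x s * (\<Sum>j<d. g s j * cofactor (?M f) 0 j))"
    by (subst sum.swap) (simp add: sum_distrib_left)
  also have "\<dots> = (\<Sum>s\<in>S. x s * rdet d (f(0 := g s)))"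
    by (simp only: upd)
  finally show ?thesis .
qed

text \<open>Cramer's rule: the adjugate times the matrix is the determinant times the
  identity.\<close>

lemma rdet_basis:
  fixes f :: "nat \<Rightarrow> nat \<Rightarrow> 'a :: field"
  assumes "rdet d f \<noteq> 0"
  obtains x where "\<And>j. j < d \<Longrightarrow> y j = (\<Sum>m<d. x m * f m j)"
proof -
  define A where "A = mat d d (\<lambda>(i, j). f i j)"
  have A: "A \<in> carrier_mat d d" and dA: "det A \<noteq> 0"
    using assms by (auto simp: A_def rdet_def)
  define B where "B = adj_mat A"
  have B: "B \<in> carrier_mat d d" and BA: "B * A = det A \<cdot>\<^sub>m 1\<^sub>m d"
    using adj_mat[OF A] by (auto simp: B_def)
  have ent: "(\<Sum>m<d. B $$ (l, m) * f m j) = (if l = j then det A else 0)" if "l < d" "j < d" for l j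
  proof -
    have "(B * A) $$ (l, j) = (\<Sum>m<d. B $$ (l, m) * f m j)"
      using A B that by (auto simp: scalar_prod_def A_def atLeast0LessThan intro!: sum.cong)
    then show ?thesis
      using that by (auto simp: BA split: if_splits)
  qed
  show ?thesis
  proof
    fix j assume j: "j < d"
    let ?x = "\<lambda>m. \<Sum>l<d. y l * B $$ (l, m) / det A"
    have "(\<Sum>m<d. ?x m * f m j) = (\<Sum>m<d. \<Sum>l<d. y l / det A * (B $$ (l, m) * f m j))"
      by (simp add: sum_distrib_right mult.assoc)
    also have "\<dots> = (\<Sum>l<d. y l / det A * (\<Sum>m<d. B $$ (l, m) * f m j))"
      by (subst sum.swap) (simp add: sum_distrib_left)
    also have "\<dots> = (\<Sum>l<d. if l = j then y l else 0)"
      using j dA by (intro sum.cong refl) (auto simp: ent)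
    finally show "y j = (\<Sum>m<d. ?x m * f m j)"
      using j by simp
  qed
qed

text \<open>A basis vector that already occurs as another row gives a determinant with two equal
  rows. When most of the basis \<open>g\<close> occurs in this way, the expansion of the first row
  has only one or two surviving terms.\<close>

lemma rdet_linear_subset:
  assumes "0 < d" "S \<subseteq> {..<d}"
    and "\<And>j. j < d \<Longrightarrow> f 0 j = (\<Sum>m<d. x m * g m j)"
    and rep: "\<And>m. m < d \<Longrightarrow> m \<notin> S \<Longrightarrow> x m = 0 \<or> (\<exists>c. 0 < c \<and> c < d \<and> f c = g m)"
  shows "rdet d f = (\<Sum>m\<in>S. x m * rdet d (f(0 := g m)))"
proof -
  have "rdet d f = (\<Sum>m<d. x m * rdet d (f(0 := g m)))"
    using assms(1,3) by (intro rdet_linear) auto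
  also have "\<dots> = (\<Sum>m\<in>S. x m * rdet d (f(0 := g m)))"
  proof (rule sum.mono_neutral_right)
    show "\<forall>m\<in>{..<d} - S. x m * rdet d (f(0 := g m)) = 0"
    proof
      fix m assume m: "m \<in> {..<d} - S"
      show "x m * rdet d (f(0 := g m)) = 0"
      proof (cases "x m = 0")
        case False
        then obtain c where "0 < c" "c < d" "f c = g m"
          using rep m by blast
        then have "rdet d (f(0 := g m)) = 0"
          using assms(1) by (intro rdet_identical[of 0 d c]) auto
        then show ?thesis
          by simp
      qed simp
    qed
  qed (use assms(2) in auto)
  finally show ?thesis .
qed

lemma rdet_move_eq:
  assumes "m < d"
    and "\<And>c. c < d \<Longrightarrow> h c = (if c = 0 then f m else if c \<le> m then f (c - 1) else f c)"
  shows "rdet d h = (-1) ^ m * rdet d f"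
  using rdet_move[OF assms(1), of f] rdet_cong[of d h, OF assms(2)] by simp

section \<open>Gap determinants: Pluecker relation, periodicity, exchange of blocks\<close>

definition gap_det :: "nat \<Rightarrow> (nat \<Rightarrow> nat \<Rightarrow> 'a) \<Rightarrow> nat \<Rightarrow> nat \<Rightarrow> nat \<Rightarrow> 'a :: comm_ring_1" where
  "gap_det d v a i j = rdet d (\<lambda>c. v (a + c + (if c < i then 0 else j)))"

lemma gap_det_0: "gap_det d v a i 0 = gap_det d v a d 0"
  and gap_det_left: "gap_det d v a 0 j = gap_det d v (a + j) d 0"
  and gap_det_right: "gap_det d v a d j = gap_det d v a d 0"
  unfolding gap_det_def by (rule rdet_cong; simp add: ac_simps)+

text \<open>The rows of the nonzero determinant form a basis \<open>g\<close>; \<open>g i\<close>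
  ends its left block and \<open>g (Suc i)\<close> starts its right block. Expanding
  \<open>v a\<close> in this basis expresses the three determinants starting at \<open>v a\<close>
  by the coefficients \<open>x i\<close> and \<open>x (Suc i)\<close>, and the terms with
  \<open>x (Suc i)\<close> cancel.\<close>

lemma gap_det_Plucker:
  fixes v :: "nat \<Rightarrow> nat \<Rightarrow> 'a :: field"
  assumes i: "Suc i < d" and nz: "gap_det d v (Suc a) (Suc i) j \<noteq> 0"
  shows "gap_det d v a (Suc i) (Suc j) * gap_det d v (Suc a) (Suc i) (Suc j) =
      gap_det d v (Suc a) i (Suc j) * gap_det d v a (Suc (Suc i)) (Suc j) +
      gap_det d v (Suc a) (Suc i) j * gap_det d v a (Suc i) (Suc (Suc j))"
proof -
  define g where "g = (\<lambda>c. v (Suc a + c + (if c < Suc i then 0 else j)))"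
  define G where "G = rdet d g"
  have G: "gap_det d v (Suc a) (Suc i) j = G"
    by (simp add: G_def g_def gap_det_def)
  from nz obtain x where x: "\<And>l. l < d \<Longrightarrow> v a l = (\<Sum>m<d. x m * g m l)"
    unfolding G G_def using rdet_basis by metis
  let ?f = "\<lambda>i j c. v (a + c + (if c < i then 0 else j))"
  have 1: "gap_det d v a (Suc i) (Suc j) = x i * ((-1) ^ i * G)"
  proof -
    \<comment> \<open>The witness is the row holding \<open>g m\<close>: the left block moves down
      by one because \<open>v a\<close> precedes it, while the longer gap keeps the right block in
      place.\<close>
    have "\<exists>c. 0 < c \<and> c < d \<and> ?f (Suc i) (Suc j) c = g m" if "m < d" "m \<noteq> i" for m
      using i that by (intro exI[of _ "if m < i then Suc m else m"]) (auto simp: g_def)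
    then have "gap_det d v a (Suc i) (Suc j) = x i * rdet d ((?f (Suc i) (Suc j))(0 := g i))"
      unfolding gap_det_def using i
      by (subst rdet_linear_subset[where S = "{i}" and g = g and x = x]) (auto simp: x)
    also have "rdet d ((?f (Suc i) (Suc j))(0 := g i)) = (-1) ^ i * G"
      unfolding G_def using i by (intro rdet_move_eq) (auto simp: g_def)
    finally show ?thesis .
  qed
  have 2: "gap_det d v a (Suc (Suc i)) (Suc j) = x (Suc i) * ((-1) ^ Suc i * G)"
  proof -
    have "\<exists>c. 0 < c \<and> c < d \<and> ?f (Suc (Suc i)) (Suc j) c = g m" if "m < d" "m \<noteq> Suc i" for m
      using i that by (intro exI[of _ "if m \<le> i then Suc m else m"]) (auto simp: g_def)
    then have "gap_det d v a (Suc (Suc i)) (Suc j) =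
        x (Suc i) * rdet d ((?f (Suc (Suc i)) (Suc j))(0 := g (Suc i)))"
      unfolding gap_det_def using i
      by (subst rdet_linear_subset[where S = "{Suc i}" and g = g and x = x]) (auto simp: x)
    also have "rdet d ((?f (Suc (Suc i)) (Suc j))(0 := g (Suc i))) = (-1) ^ Suc i * G"
      unfolding G_def using i by (intro rdet_move_eq) (auto simp: g_def)
    finally show ?thesis .
  qed
  have 3: "gap_det d v a (Suc i) (Suc (Suc j)) =
      x i * ((-1) ^ i * gap_det d v (Suc a) (Suc i) (Suc j)) +
      x (Suc i) * ((-1) ^ i * gap_det d v (Suc a) i (Suc j))"
  proof -
    \<comment> \<open>With the gap longer by two, both \<open>g i\<close> and
      \<open>g (Suc i)\<close> are missing from the rows, so two terms survive.\<close>
    let ?F = "?f (Suc i) (Suc (Suc j))"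
    have "\<exists>c. 0 < c \<and> c < d \<and> ?F c = g m" if "m < d" "m \<noteq> i" "m \<noteq> Suc i" for m
      using i that by (intro exI[of _ "if m < i then Suc m else m - 1"]) (auto simp: g_def)
    then have "gap_det d v a (Suc i) (Suc (Suc j)) =
        (\<Sum>m\<in>{i, Suc i}. x m * rdet d (?F(0 := g m)))"
      unfolding gap_det_def using i
      by (intro rdet_linear_subset) (auto simp: x)
    moreover have "rdet d (?F(0 := g i)) = (-1) ^ i * gap_det d v (Suc a) (Suc i) (Suc j)"
      unfolding gap_det_def using i by (intro rdet_move_eq) (auto simp: g_def)
    moreover have "rdet d (?F(0 := g (Suc i))) = (-1) ^ i * gap_det d v (Suc a) i (Suc j)"
      unfolding gap_det_def using i by (intro rdet_move_eq) (auto simp: g_def)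
    ultimately show ?thesis
      by simp
  qed
  show ?thesis
    unfolding 1 2 3 G by (simp add: algebra_simps)
qed

text \<open>Of the \<open>d\<close> vectors after \<open>v a\<close>, only the one with coefficient
  \<open>e i\<close> is skipped by the gap. Choosing the recurrence thus prescribes the determinants
  with gap 1.\<close>

lemma gap_det_1:
  fixes v :: "nat \<Rightarrow> nat \<Rightarrow> 'a :: field"
  assumes i: "i < d" and rec: "\<And>l. l < d \<Longrightarrow> v a l = (\<Sum>m<d. e m * v (Suc a + m) l)"
  shows "gap_det d v a (Suc i) 1 = (-1) ^ i * e i * gap_det d v (Suc a) d 0"
proof -
  let ?F = "\<lambda>c. v (a + c + (if c < Suc i then 0 else 1))"
  let ?g = "\<lambda>m. v (Suc a + m)"
  have "\<exists>c. 0 < c \<and> c < d \<and> ?F c = ?g m" if "m < d" "m \<noteq> i" for m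
    using i that by (intro exI[of _ "if m < i then Suc m else m"]) auto
  then have "gap_det d v a (Suc i) 1 = e i * rdet d (?F(0 := ?g i))"
    unfolding gap_det_def using i
    by (subst rdet_linear_subset[where S = "{i}" and g = ?g and x = e]) (auto simp: rec)
  also have "rdet d (?F(0 := ?g i)) = (-1) ^ i * gap_det d v (Suc a) d 0"
    unfolding gap_det_def using i by (intro rdet_move_eq) auto
  finally show ?thesis
    by simp
qed

lemma gap_det_periodic:
  fixes v :: "nat \<Rightarrow> nat \<Rightarrow> 'a :: field"
  assumes zero: "\<And>a i. 0 < i \<Longrightarrow> i < d \<Longrightarrow> gap_det d v a i (Suc (Suc k)) = 0"
    and nz: "\<And>a i. i \<le> d \<Longrightarrow> gap_det d v a i (Suc k) \<noteq> 0"
    and d: "0 < d"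
  shows "\<exists>\<mu>. \<forall>a. \<mu> a \<noteq> 0 \<and> (\<forall>l<d. v (a + d + Suc k) l = \<mu> a * v a l)"
proof -
  \<comment> \<open>In the basis \<open>g\<close>, the vanishing determinants kill all coefficients of \<open>v a\<close> but the last,
    one after the other.\<close>
  have "\<exists>t. t \<noteq> 0 \<and> (\<forall>l<d. v (a + d + Suc k) l = t * v a l)" for a
  proof -
    \<comment> \<open>The last vector \<open>g (d - 1)\<close> is \<open>v (a + d + Suc k)\<close>;
      that \<open>g\<close> is a basis is the nonvanishing at \<open>i = 0\<close>.\<close>
    define g where "g = (\<lambda>m. v (Suc a + m + Suc k))"
    have "rdet d g = gap_det d v (Suc a) 0 (Suc k)"
      by (simp add: gap_det_def g_def)
    then have "rdet d g \<noteq> 0"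
      using nz[of 0] by simp
    then obtain x where x: "\<And>l. l < d \<Longrightarrow> v a l = (\<Sum>m<d. x m * g m l)"
      using rdet_basis by metis
    have x0: "x m = 0" if "Suc m < d" for m
      using that
    proof (induction m rule: less_induct)
      case (less m)
      let ?F = "\<lambda>c. v (a + c + (if c < Suc m then 0 else Suc (Suc k)))"
      have "x m' = 0 \<or> (\<exists>c. 0 < c \<and> c < d \<and> ?F c = g m')" if "m' < d" "m' \<noteq> m" for m'
      proof (cases "m' < m")
        case False
        then show ?thesis
          using that by (intro disjI2 exI[of _ m']) (auto simp: g_def)
      qed (use less in auto)
      then have "gap_det d v a (Suc m) (Suc (Suc k)) = x m * rdet d (?F(0 := g m))"
        unfolding gap_det_def using less.prems
        by (subst rdet_linear_subset[where S = "{m}" and g = g and x = x]) (auto simp: x)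
      also have "rdet d (?F(0 := g m)) = (-1) ^ m * gap_det d v (Suc a) m (Suc k)"
        unfolding gap_det_def using less.prems by (intro rdet_move_eq) (auto simp: g_def)
      finally show ?case
        using zero[of "Suc m" a] nz[of m "Suc a"] less.prems by simp
    qed
    have va: "v a l = x (d - 1) * v (a + d + Suc k) l" if "l < d" for l
    proof -
      have "v a l = (\<Sum>m\<in>{d - 1}. x m * g m l)"
        unfolding x[OF that] using d x0 by (intro sum.mono_neutral_right) auto
      then show ?thesis
        using d by (simp add: g_def)
    qed
    have "x (d - 1) \<noteq> 0"
    proof
      assume "x (d - 1) = 0"
      then have "gap_det d v a d (Suc k) = 0"
        unfolding gap_det_def using d va
        by (subst rdet_linear_subset[where S = "{}" and x = "\<lambda>_. 0"]) auto
      then show False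
        using nz by blast
    qed
    then show ?thesis
      using va by (intro exI[of _ "1 / x (d - 1)"]) auto
  qed
  then show ?thesis
    by metis
qed

text \<open>Each step drops the top row and appends its multiple at the bottom, which costs a cycle
  of sign \<open>(-1) ^ (d - 1)\<close> and a factor \<open>\<mu>\<close>.\<close>

lemma rdet_rotate:
  assumes d: "0 < d" and per: "\<And>p l. p < i \<Longrightarrow> l < d \<Longrightarrow> w (p + d) l = \<mu> p * w p l"
  shows "rdet d (\<lambda>c. w (c + i)) = ((-1) ^ (d - 1)) ^ i * (\<Prod>p<i. \<mu> p) * rdet d w"
  using per
proof (induction i)
  case (Suc i)
  let ?F = "\<lambda>c. w (c + Suc i)" and ?H = "\<lambda>c. if c = 0 then w (i + d) else w (c + i)"
  have "rdet d ?H = (-1) ^ (d - 1) * rdet d ?F"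
    using d by (intro rdet_move_eq) (auto simp: ac_simps)
  moreover have "rdet d ?H = \<mu> i * rdet d (\<lambda>c. w (c + i))"
  proof -
    have "rdet d ?H = \<mu> i * rdet d (?H(0 := w i))"
      using d Suc.prems
      by (subst rdet_linear[where S = "{i}" and x = \<mu> and g = w]) auto
    also have "?H(0 := w i) = (\<lambda>c. w (c + i))"
      by auto
    finally show ?thesis .
  qed
  ultimately have "(-1) ^ (d - 1) * ((-1) ^ (d - 1) * rdet d ?F)
      = (-1) ^ (d - 1) * (\<mu> i * rdet d (\<lambda>c. w (c + i)))"
    by simp
  then have "rdet d ?F = (-1) ^ (d - 1) * \<mu> i * rdet d (\<lambda>c. w (c + i))"
    by (simp flip: mult.assoc power_add power_mult_distrib)
  then show ?case
    using Suc by (simp add: ac_simps)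
qed simp

lemma gap_det_glide:
  assumes d: "0 < d" and i: "i \<le> d" and j: "j \<le> Suc k"
    and per: "\<And>a l. l < d \<Longrightarrow> v (a + d + Suc k) l = \<mu> a * v a l"
  shows "gap_det d v (a + i + j) (d - i) (Suc k - j) =
    ((-1) ^ (d - 1)) ^ i * (\<Prod>p<i. \<mu> (a + p)) * gap_det d v a i j"
proof -
  \<comment> \<open>The window lists the left block, the right block, and the left block one period
    later; sliding it by \<open>i\<close> rows exchanges the two blocks.\<close>
  define w where "w = (\<lambda>p. if p < i then v (a + p) else if p < d then v (a + p + j) else v (a + p + Suc k))"
  have "gap_det d v (a + i + j) (d - i) (Suc k - j) = rdet d (\<lambda>c. w (c + i))"
    unfolding gap_det_def using i j by (intro rdet_cong) (auto simp: w_def ac_simps)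
  also have "\<dots> = ((-1) ^ (d - 1)) ^ i * (\<Prod>p<i. \<mu> (a + p)) * rdet d w"
    using d i per[of _ "a + _"] by (intro rdet_rotate) (auto simp: w_def ac_simps)
  also have "rdet d w = gap_det d v a i j"
    unfolding gap_det_def using i by (intro rdet_cong) (auto simp: w_def)
  finally show ?thesis .
qed

section \<open>Sequences given by a linear recurrence\<close>

text \<open>The recurrence of \<open>lin_seq_rec\<close> is solved for its last vector. The unit
  vectors as initial values normalise the first determinant to 1.\<close>

function lin_seq :: "nat \<Rightarrow> (nat \<Rightarrow> nat \<Rightarrow> 'a) \<Rightarrow> nat \<Rightarrow> nat \<Rightarrow> 'a :: field" where
  "lin_seq d e n l =
    (if n < d \<or> d = 0 then if n = l then 1 else 0
     else (lin_seq d e (n - d) l - (\<Sum>m<d - 1. e (n - d) m * lin_seq d e (Suc (n - d) + m) l))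
       / e (n - d) (d - 1))"
  by auto
termination
  by (relation "measure (\<lambda>(d, e, n, l). n)") auto

declare lin_seq.simps [simp del]

lemma lin_seq_rec:
  assumes "0 < d" "e a (d - 1) \<noteq> 0"
  shows "lin_seq d e a l = (\<Sum>m<d. e a m * lin_seq d e (Suc a + m) l)"
proof -
  have "lin_seq d e (a + d) l = (lin_seq d e a l - (\<Sum>m<d - 1. e a m * lin_seq d e (Suc a + m) l)) / e a (d - 1)"
    using assms(1) by (subst lin_seq.simps) simp
  moreover have "(\<Sum>m<d. e a m * lin_seq d e (Suc a + m) l) =
      (\<Sum>m<d - 1. e a m * lin_seq d e (Suc a + m) l) + e a (d - 1) * lin_seq d e (a + d) l"
    using assms(1) by (cases d) simp_all
  ultimately show ?thesis
    using assms(2) by simp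
qed

lemma gap_det_lin_seq_0: "gap_det d (lin_seq d e) 0 d 0 = 1"
proof -
  have "gap_det d (lin_seq d e) 0 d 0 = rdet d (\<lambda>i j. if i = j then 1 else 0)"
    unfolding gap_det_def by (rule rdet_cong) (auto simp: lin_seq.simps)
  then show ?thesis
    by (simp add: rdet_unit_vectors)
qed

text \<open>For \<open>p = 1 + Y\<close> and \<open>q = 1 + 1 / Y\<close> the third hypothesis
  holds. Here \<open>X = (q - 1) * R\<close> and \<open>p * (q - 1) = q\<close>. This turns a
  formula for one kind of factor into one for the other.\<close>

lemma cancel_identity:
  fixes p q :: "'a :: field"
  assumes "L = R + X" "L = q * R" "p * q = p + q" "q \<noteq> 0"
  shows "L = p * X"
proof -
  have "X = L - R"
    by (simp add: assms(1))
  then have "q * (p * X) = p * q * L - p * (q * R)"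
    by (simp only: right_diff_distrib ac_simps)
  also have "\<dots> = q * L"
    unfolding assms(3) assms(2)[symmetric] by (simp add: algebra_simps)
  finally have "q * L = q * (p * X)" ..
  then show ?thesis
    using assms(4) by simp
qed

section \<open>The system in natural-number coordinates and its determinant solution\<close>

definition Y_num :: "nat \<Rightarrow> nat \<Rightarrow> (nat \<Rightarrow> nat \<Rightarrow> nat \<Rightarrow> 'a :: field) \<Rightarrow> nat \<Rightarrow> nat \<Rightarrow> nat \<Rightarrow> 'a" where
  "Y_num r k y a i j = (if 1 \<le> i \<and> i \<le> r \<and> 1 \<le> j \<and> j \<le> k then 1 + y a i j else 1)"

definition Y_den :: "nat \<Rightarrow> nat \<Rightarrow> (nat \<Rightarrow> nat \<Rightarrow> nat \<Rightarrow> 'a :: field) \<Rightarrow> nat \<Rightarrow> nat \<Rightarrow> nat \<Rightarrow> 'a" where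
  "Y_den r k y a i j = (if 1 \<le> i \<and> i \<le> r \<and> 1 \<le> j \<and> j \<le> k then 1 + 1 / y a i j else 1)"

text \<open>All sites in one equation have the same parity of \<open>n + i + j\<close>, so
  \<open>n = 2 a + i + j + const\<close> is a valid coordinate. A neighbour with smaller
  \<open>i\<close> or \<open>j\<close> then has index \<open>Suc a\<close>, one with larger
  \<open>i\<close> or \<open>j\<close> has index \<open>a\<close>.\<close>

locale regular_Y_system =
  fixes r k :: nat and y :: "nat \<Rightarrow> nat \<Rightarrow> nat \<Rightarrow> 'a :: field"
  assumes y_nz: "\<lbrakk>1 \<le> i; i \<le> r; 1 \<le> j; j \<le> k\<rbrakk> \<Longrightarrow> y a i j \<noteq> 0"
    and y_nm1: "\<lbrakk>1 \<le> i; i \<le> r; 1 \<le> j; j \<le> k\<rbrakk> \<Longrightarrow> 1 + y a i j \<noteq> 0"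
    and Y_sys: "\<lbrakk>Suc i \<le> r; Suc j \<le> k\<rbrakk> \<Longrightarrow>
      y a (Suc i) (Suc j) * y (Suc a) (Suc i) (Suc j) *
        (Y_den r k y a (Suc i) (Suc (Suc j)) * Y_den r k y (Suc a) (Suc i) j) =
      Y_num r k y (Suc a) i (Suc j) * Y_num r k y a (Suc (Suc i)) (Suc j)"
begin

abbreviation "num \<equiv> Y_num r k y"
abbreviation "den \<equiv> Y_den r k y"

lemma den_nz: "den a i j \<noteq> 0"
  using y_nz[of i j a] y_nm1[of i j a] by (auto simp: Y_den_def field_simps)

lemma num_eq: "\<lbrakk>1 \<le> i; i \<le> r; 1 \<le> j; j \<le> k\<rbrakk> \<Longrightarrow> num a i j = y a i j * den a i j"
  using y_nz[of i j a] by (simp add: Y_num_def Y_den_def field_simps)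

lemma num_den: "\<lbrakk>1 \<le> i; i \<le> r; 1 \<le> j; j \<le> k\<rbrakk> \<Longrightarrow> num a i j * den a i j = num a i j + den a i j"
  using y_nz[of i j a] by (simp add: Y_num_def Y_den_def field_simps)

text \<open>The \<open>Y\<close>-system fixes only products along \<open>j = 1\<close>; \<open>coef (Suc 0) = 1\<close> is a choice of gauge,
  that is, of scaling of the vectors.\<close>

fun coef :: "nat \<Rightarrow> nat \<Rightarrow> 'a" where
  "coef 0 a = 1"
| "coef (Suc 0) a = 1"
| "coef (Suc (Suc i)) a = coef (Suc i) a * coef (Suc i) (Suc a) / (den a (Suc i) 1 * coef i (Suc a))"

lemma coef_nz: "coef i a \<noteq> 0"
  by (induction i a rule: coef.induct) (auto simp: den_nz)

abbreviation "d \<equiv> Suc r"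

text \<open>The signs cancel those of \<open>gap_det_1\<close>, so by \<open>D_1\<close> the numbers
  \<open>coef i a\<close> are the determinants with gap 1 up to a factor independent of
  \<open>i\<close>.\<close>

definition "v = lin_seq d (\<lambda>a m. (-1) ^ m * coef (Suc m) a)"

abbreviation "D \<equiv> gap_det d v"

lemma v_rec: "v a l = (\<Sum>m<d. (-1) ^ m * coef (Suc m) a * v (Suc a + m) l)"
  unfolding v_def by (rule lin_seq_rec) (auto simp: coef_nz)

lemma D_1: "i \<le> d \<Longrightarrow> D a i 1 = coef i a * D (Suc a) d 0"
proof (cases i)
  case 0
  then show ?thesis
    by (simp add: gap_det_left)
next
  case (Suc m)
  assume "i \<le> d"
  then have "D a (Suc m) 1 = (-1) ^ m * ((-1) ^ m * coef (Suc m) a) * D (Suc a) d 0"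
    using Suc by (intro gap_det_1 v_rec) auto
  then show ?thesis
    using Suc by (simp flip: mult.assoc power_mult_distrib)
qed

lemma D_0_nz: "D a d 0 \<noteq> 0"
proof (induction a)
  case 0
  then show ?case
    by (simp add: v_def gap_det_lin_seq_0)
next
  case (Suc a)
  have "D a d 0 = coef d a * D (Suc a) d 0"
    using D_1[of d a] gap_det_right[of d v a 1] by simp
  with Suc show ?case
    by auto
qed

section \<open>Induction on the gap\<close>

text \<open>The invariant: \<open>1 + 1 / y\<close> is the expected ratio of nonzero determinants.
  At \<open>j = 0\<close> and \<open>j = Suc k\<close> the factor \<open>den\<close> is 1 by the
  omission convention.\<close>

definition gap_regular :: "nat \<Rightarrow> bool" where
  "gap_regular j \<longleftrightarrow> (\<forall>a i. i \<le> d \<longrightarrow> D a i j \<noteq> 0) \<and>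
    (\<forall>a i. i < r \<longrightarrow> D a (Suc i) j * D (Suc a) (Suc i) j =
      den a (Suc i) j * (D (Suc a) i j * D a (Suc (Suc i)) j))"

lemma gap_regular_0: "gap_regular 0"
proof -
  define h where "h a = D a d 0" for a
  have "D a i 0 = h a" for a i
    unfolding h_def by (rule gap_det_0)
  moreover have "h a \<noteq> 0" for a
    by (simp add: h_def D_0_nz)
  ultimately show ?thesis
    by (simp add: gap_regular_def Y_den_def)
qed

lemma gap_regular_1: "gap_regular 1"
proof -
  have "coef (Suc i) a * coef (Suc i) (Suc a) = den a (Suc i) 1 * (coef i (Suc a) * coef (Suc (Suc i)) a)" for a i
    using den_nz[of a "Suc i" 1] coef_nz[of i "Suc a"] by simp
  note c = this
  have "D a (Suc i) 1 * D (Suc a) (Suc i) 1 =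
      den a (Suc i) 1 * (D (Suc a) i 1 * D a (Suc (Suc i)) 1)" if "i < r" for a i
  proof -
    have "i \<le> d" "Suc i \<le> d" "Suc (Suc i) \<le> d"
      using that by auto
    then have "D a (Suc i) 1 * D (Suc a) (Suc i) 1 =
        (coef (Suc i) a * coef (Suc i) (Suc a)) * (D (Suc a) d 0 * D (Suc (Suc a)) d 0)"
      and "D (Suc a) i 1 * D a (Suc (Suc i)) 1 =
        (coef i (Suc a) * coef (Suc (Suc i)) a) * (D (Suc a) d 0 * D (Suc (Suc a)) d 0)"
      by (simp_all only: D_1 ac_simps)
    then show ?thesis
      by (simp only: c mult.assoc)
  qed
  moreover have "D a i 1 \<noteq> 0" if "i \<le> d" for a i
    unfolding D_1[OF that] using D_0_nz coef_nz by simp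
  ultimately show ?thesis
    by (simp only: gap_regular_def) blast
qed

text \<open>Inside, the Pluecker relation converts the formula for \<open>den\<close> into one for
  \<open>num\<close>. At \<open>i = 0\<close> and \<open>i = d\<close> all determinants have
  consecutive vectors and both sides agree trivially.\<close>

lemma D_num:
  assumes "gap_regular j" "gap_regular (Suc j)" "Suc j \<le> k" "i \<le> d"
  shows "D a i (Suc j) * D (Suc a) i (Suc j) = num a i (Suc j) * (D (Suc a) i j * D a i (Suc (Suc j)))"
proof -
  consider "i = 0" | "i = d" | m where "i = Suc m" "m < r"
    using assms(4) by (cases i) (auto simp: le_less)
  then show ?thesis
  proof cases
    case 1
    then show ?thesis
      by (simp add: gap_det_left Y_num_def)
  next
    case 2
    then show ?thesis
      by (simp add: gap_det_right[of d v _ j] gap_det_right[of d v _ "Suc _"] Y_num_def)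
  next
    case (3 m)
    let ?L = "D a i (Suc j) * D (Suc a) i (Suc j)"
    let ?R = "D (Suc a) m (Suc j) * D a (Suc (Suc m)) (Suc j)"
    let ?X = "D (Suc a) i j * D a i (Suc (Suc j))"
    have "?L = ?R + ?X"
      unfolding 3(1) using 3 assms(1) by (intro gap_det_Plucker) (auto simp: gap_regular_def)
    moreover have "?L = den a i (Suc j) * ?R"
      using assms(2) 3 by (auto simp: gap_regular_def)
    moreover have "num a i (Suc j) * den a i (Suc j) = num a i (Suc j) + den a i (Suc j)"
      using 3 assms(3) by (intro num_den) auto
    ultimately show ?thesis
      using den_nz by (rule cancel_identity)
  qed
qed

lemma gap_regular_step:
  assumes g: "gap_regular j" "gap_regular (Suc j)" and j: "Suc j \<le> k"
  shows "gap_regular (Suc (Suc j))"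
proof -
  have nz: "D a i j' \<noteq> 0" if "i \<le> d" "j' \<in> {j, Suc j}" for a i j'
    using g that by (auto simp: gap_regular_def)
  have nz2: "D a i (Suc (Suc j)) \<noteq> 0" if "i \<le> d" for a i
    using D_num[OF g j that, of a] nz[OF that] by auto
  moreover have "D a (Suc i) (Suc (Suc j)) * D (Suc a) (Suc i) (Suc (Suc j)) =
      den a (Suc i) (Suc (Suc j)) * (D (Suc a) i (Suc (Suc j)) * D a (Suc (Suc i)) (Suc (Suc j)))"
    if i: "i < r" for a i
  proof -
    note P = D_num[OF g j]
    have Q: "D a (Suc i) j' * D (Suc a) (Suc i) j' =
      den a (Suc i) j' * (D (Suc a) i j' * D a (Suc (Suc i)) j')" if "j' \<in> {j, Suc j}" for a j'
      using g i that by (auto simp: gap_regular_def)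
    define G where "G = D (Suc (Suc a)) i j"
    define H where "H = D (Suc a) (Suc (Suc i)) j"
    define q0 where "q0 = den a (Suc i) (Suc j)"
    define q1 where "q1 = den (Suc a) (Suc i) (Suc j)"
    define q2 where "q2 = den (Suc a) (Suc i) j"
    define q3 where "q3 = den a (Suc i) (Suc (Suc j))"
    define y0 where "y0 = y a (Suc i) (Suc j)"
    define y1 where "y1 = y (Suc a) (Suc i) (Suc j)"
    define pm where "pm = num (Suc a) i (Suc j)"
    define pk where "pk = num a (Suc (Suc i)) (Suc j)"
    have p: "num a (Suc i) (Suc j) = y0 * q0" "num (Suc a) (Suc i) (Suc j) = y1 * q1"
      unfolding y0_def y1_def q0_def q1_def using i j by (auto intro!: num_eq)
    have Y: "y0 * y1 * (q3 * q2) = pm * pk"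
      unfolding y0_def y1_def q2_def q3_def pm_def pk_def using i j by (intro Y_sys) auto
    have e1: "D a (Suc i) (Suc j) * D (Suc a) (Suc i) (Suc j) =
        y0 * q0 * (D (Suc a) (Suc i) j * D a (Suc i) (Suc (Suc j)))"
      using P[of "Suc i" a] i by (simp add: p)
    have e2: "D (Suc a) (Suc i) (Suc j) * D (Suc (Suc a)) (Suc i) (Suc j) =
        y1 * q1 * (D (Suc (Suc a)) (Suc i) j * D (Suc a) (Suc i) (Suc (Suc j)))"
      using P[of "Suc i" "Suc a"] i by (simp add: p)
    have e3: "D (Suc a) i (Suc j) * D (Suc (Suc a)) i (Suc j) =
        pm * (G * D (Suc a) i (Suc (Suc j)))"
      using P[of i "Suc a"] i by (simp add: pm_def G_def)
    have e4: "D a (Suc (Suc i)) (Suc j) * D (Suc a) (Suc (Suc i)) (Suc j) =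
        pk * (H * D a (Suc (Suc i)) (Suc (Suc j)))"
      using P[of "Suc (Suc i)" a] i by (simp add: pk_def H_def)
    have e5: "D a (Suc i) (Suc j) * D (Suc a) (Suc i) (Suc j) =
        q0 * (D (Suc a) i (Suc j) * D a (Suc (Suc i)) (Suc j))"
      unfolding q0_def by (rule Q) simp
    have e6: "D (Suc a) (Suc i) (Suc j) * D (Suc (Suc a)) (Suc i) (Suc j) =
        q1 * (D (Suc (Suc a)) i (Suc j) * D (Suc a) (Suc (Suc i)) (Suc j))"
      unfolding q1_def by (rule Q) simp
    have e7: "D (Suc a) (Suc i) j * D (Suc (Suc a)) (Suc i) j = q2 * (G * H)"
      unfolding q2_def G_def H_def by (rule Q) simp
    let ?L = "D a (Suc i) (Suc (Suc j)) * D (Suc a) (Suc i) (Suc (Suc j))"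
    let ?R = "D (Suc a) i (Suc (Suc j)) * D a (Suc (Suc i)) (Suc (Suc j))"
    \<comment> \<open>By \<open>e7\<close>, \<open>c * ?L\<close> is the product of the right-hand
      sides of \<open>e1\<close> and \<open>e2\<close>. Rewriting it by \<open>e5\<close> and
      \<open>e6\<close>, then \<open>e3\<close> and \<open>e4\<close>, leaves
      \<open>pm * pk\<close>, where the \<open>Y\<close>-system brings in \<open>q3\<close>.\<close>
    define c where "c = y0 * q0 * y1 * q1 * (q2 * (G * H))"
    have c: "c \<noteq> 0"
      unfolding c_def y0_def y1_def q0_def q1_def q2_def G_def H_def
      using i j by (auto simp: den_nz y_nz nz)
    have "c * ?L = (y0 * q0 * (D (Suc a) (Suc i) j * D a (Suc i) (Suc (Suc j)))) *
        (y1 * q1 * (D (Suc (Suc a)) (Suc i) j * D (Suc a) (Suc i) (Suc (Suc j))))"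
      unfolding c_def e7[symmetric] by (simp only: ac_simps)
    also have "\<dots> = q0 * (D (Suc a) i (Suc j) * D a (Suc (Suc i)) (Suc j)) *
        (q1 * (D (Suc (Suc a)) i (Suc j) * D (Suc a) (Suc (Suc i)) (Suc j)))"
      unfolding e1[symmetric] e2[symmetric] e5 e6 ..
    also have "\<dots> = q0 * q1 * (pm * (G * D (Suc a) i (Suc (Suc j)))) *
        (pk * (H * D a (Suc (Suc i)) (Suc (Suc j))))"
      unfolding e3[symmetric] e4[symmetric] by (simp add: ac_simps)
    also have "\<dots> = q0 * q1 * (pm * pk) * (G * H) * ?R"
      by (simp only: ac_simps)
    also have "\<dots> = c * (q3 * ?R)"
      unfolding c_def Y[symmetric] by (simp only: ac_simps)
    finally show ?thesis
      using c by (simp add: q3_def)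
  qed
  ultimately show ?thesis
    by (simp add: gap_regular_def)
qed

lemma gap_regular: "j \<le> Suc k \<Longrightarrow> gap_regular j"
proof (induction j rule: less_induct)
  case (less j)
  consider "j = 0" | "j = 1" | m where "j = Suc (Suc m)"
    by (metis One_nat_def not0_implies_Suc)
  then show ?case
  proof cases
    case (3 m)
    then show ?thesis
      using less by (auto intro!: gap_regular_step)
  qed (use gap_regular_0 gap_regular_1 in auto)
qed

lemma D_nz: "j \<le> Suc k \<Longrightarrow> i \<le> d \<Longrightarrow> D a i j \<noteq> 0"
  using gap_regular by (auto simp: gap_regular_def)

section \<open>The boundary at \<open>j = k\<close> and the glide symmetry\<close>

text \<open>At gap \<open>Suc k\<close> the factor \<open>den\<close> is 1, so the last product in
  the Pluecker relation vanishes, and one of its factors is nonzero.\<close>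

lemma D_zero:
  assumes "0 < i" "i < d"
  shows "D a i (Suc (Suc k)) = 0"
proof -
  obtain m where m: "i = Suc m" "m < r"
    using assms by (cases i) auto
  have "D a i (Suc k) * D (Suc a) i (Suc k) = D (Suc a) m (Suc k) * D a (Suc (Suc m)) (Suc k)"
    using gap_regular[of "Suc k"] m by (simp add: gap_regular_def Y_den_def)
  moreover have "D a i (Suc k) * D (Suc a) i (Suc k) =
      D (Suc a) m (Suc k) * D a (Suc (Suc m)) (Suc k) + D (Suc a) i k * D a i (Suc (Suc k))"
    unfolding m(1) using m by (intro gap_det_Plucker D_nz) auto
  ultimately show ?thesis
    using D_nz[of k i "Suc a"] assms by simp
qed

text \<open>The index \<open>a + i + j\<close> is the shift of \<open>n\<close> by
  \<open>r + k + 2\<close> in the coordinate \<open>a\<close>. Exchanging blocks swaps the gaps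
  \<open>j - 1\<close> and \<open>j + 1\<close> in the formula for \<open>num\<close>, and each side
  picks up \<open>\<Lambda> a * \<Lambda> (Suc a)\<close>.\<close>

lemma glide_symmetry:
  assumes i: "1 \<le> i" "i \<le> r" and j: "1 \<le> j" "j \<le> k"
  shows "y (a + i + j) (r + 1 - i) (k + 1 - j) = y a i j"
proof -
  obtain \<mu> where mu: "\<And>a. \<mu> a \<noteq> 0"
    and per: "\<And>a l. l < d \<Longrightarrow> v (a + d + Suc k) l = \<mu> a * v a l"
    using gap_det_periodic[of d v k, OF D_zero D_nz] by auto
  define \<Lambda> where "\<Lambda> a = (((-1) ^ (d - 1)) ^ i * (\<Prod>p<i. \<mu> (a + p)) :: 'a)" for a
  have \<Lambda>_nz: "\<Lambda> a \<noteq> 0" for a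
    by (simp add: \<Lambda>_def mu)
  have glide: "D (a + i + j) (d - i) (Suc k - j) = \<Lambda> a * D a i j" if "j \<le> Suc k" for a j
    unfolding \<Lambda>_def using i that per by (intro gap_det_glide) auto
  obtain j1 where j1: "j = Suc j1" "j1 < k"
    using j by (cases j) auto
  have num: "D a i' (Suc j') * D (Suc a) i' (Suc j') =
      num a i' (Suc j') * (D (Suc a) i' j' * D a i' (Suc (Suc j')))" if "Suc j' \<le> k" "i' \<le> d" for a i' j'
    using that by (intro D_num gap_regular) auto
  let ?b = "a + i + j"
  have "D ?b (d - i) (Suc (k - j)) = \<Lambda> a * D a i j"
    using glide[of j a] j by (simp add: Suc_diff_le)
  moreover have "D (Suc ?b) (d - i) (Suc (k - j)) = \<Lambda> (Suc a) * D (Suc a) i j"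
    using glide[of j "Suc a"] j by (simp add: Suc_diff_le)
  moreover have "D (Suc ?b) (d - i) (k - j) = \<Lambda> a * D a i (Suc j)"
    using glide[of "Suc j" a] j by simp
  moreover have "D ?b (d - i) (Suc (Suc (k - j))) = \<Lambda> (Suc a) * D (Suc a) i j1"
  proof -
    have "Suc k - j1 = Suc (Suc (k - j))" "Suc a + i + j1 = ?b"
      using j j1 by auto
    then show ?thesis
      using glide[of j1 "Suc a"] j1 by (simp only:)
  qed
  moreover have "D ?b (d - i) (Suc (k - j)) * D (Suc ?b) (d - i) (Suc (k - j)) =
      num ?b (d - i) (Suc (k - j)) * (D (Suc ?b) (d - i) (k - j) * D ?b (d - i) (Suc (Suc (k - j))))"
    using j by (intro num) auto
  ultimately have "(\<Lambda> a * \<Lambda> (Suc a)) * (D a i j * D (Suc a) i j) =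
      (\<Lambda> a * \<Lambda> (Suc a)) * (num ?b (d - i) (Suc (k - j)) * (D (Suc a) i j1 * D a i (Suc j)))"
    by (simp only: ac_simps)
  then have "D a i j * D (Suc a) i j = num ?b (d - i) (Suc (k - j)) * (D (Suc a) i j1 * D a i (Suc j))"
    using \<Lambda>_nz by simp
  moreover have "D a i j * D (Suc a) i j = num a i j * (D (Suc a) i j1 * D a i (Suc j))"
    using num[of j1 i a] i j1 by simp
  ultimately have "num ?b (d - i) (Suc (k - j)) * (D (Suc a) i j1 * D a i (Suc j)) =
      num a i j * (D (Suc a) i j1 * D a i (Suc j))"
    by (rule trans[OF sym])
  moreover have "D (Suc a) i j1 * D a i (Suc j) \<noteq> 0"
    using i j j1 by (simp add: D_nz)
  ultimately have "num ?b (d - i) (Suc (k - j)) = num a i j"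
    by (simp only: mult_cancel_right) simp
  moreover have "d - i = r + 1 - i" "Suc (k - j) = k + 1 - j"
    using i j by auto
  ultimately have "num ?b (r + 1 - i) (k + 1 - j) = num a i j"
    by (simp only:)
  moreover have "1 \<le> r + 1 - i" "r + 1 - i \<le> r" "1 \<le> k + 1 - j" "k + 1 - j \<le> k"
    using i j by auto
  ultimately show ?thesis
    using i j by (simp only: Y_num_def simp_thms if_True add_left_cancel)
qed

end

section \<open>Return to integer indices\<close>

theorem theorem3p1:
  fixes r k :: int and Y :: "int \<times> int \<times> int \<Rightarrow> complex"
  assumes "r \<ge> 1" and "k \<ge> 1"
    and "\<forall>s \<in> Lam r k. Y s \<noteq> 0"
    and "truncated_Y_system r k Y"
  shows "\<forall>n i j. (n, i, j) \<in> Lam r k \<longrightarrow>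
           Y (n, i, j) = Y (n + r + k + 2, r + 1 - i, k + 1 - j)"
proof (intro allI impI)
  fix n i j
  assume site: "(n, i, j) \<in> Lam r k"
  have nz: "Y s \<noteq> 0" if "s \<in> Lam r k" for s
    using assms(3) that by blast
  have den: "den_factor r k Y (n, i, j + 1) \<noteq> 0" "den_factor r k Y (n, i, j - 1) \<noteq> 0"
    if "(n, i, j) \<in> Lam r k" for n i j
    using assms(4) that unfolding truncated_Y_system_def by blast+
  have eq: "Y (n - 1, i, j) * Y (n + 1, i, j) *
      (den_factor r k Y (n, i, j + 1) * den_factor r k Y (n, i, j - 1)) =
      num_factor r k Y (n, i - 1, j) * num_factor r k Y (n, i + 1, j)"
    if "(n, i, j) \<in> Lam r k" for n i j
  proof -
    have "Y (n - 1, i, j) * Y (n + 1, i, j) =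
          (num_factor r k Y (n, i - 1, j) * num_factor r k Y (n, i + 1, j)) /
          (den_factor r k Y (n, i, j + 1) * den_factor r k Y (n, i, j - 1))"
      using assms(4) that unfolding truncated_Y_system_def by blast
    then show ?thesis
      using den[OF that] by simp
  qed
  show "Y (n, i, j) = Y (n + r + k + 2, r + 1 - i, k + 1 - j)"
  proof (cases "r = 1 \<and> k = 1")
    \<comment> \<open>A single site has no neighbours, so -1 is a possible value; the product of
      values two steps apart is 1, which gives period 4.\<close>
    case True
    have *: "Y (m - 1, 1, 1) * Y (m + 1, 1, 1) = 1" for m
      using eq[of m 1 1] True by (simp add: Lam_def num_factor_def den_factor_def)
    have "Y (n + 2, 1, 1) * Y (n, 1, 1) = 1" "Y (n + 2, 1, 1) * Y (n + 4, 1, 1) = 1"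
      using *[of "n + 1"] *[of "n + 3"] by (simp_all add: ac_simps)
    then have "Y (n + 2, 1, 1) * Y (n, 1, 1) = Y (n + 2, 1, 1) * Y (n + 4, 1, 1)"
      by (simp only:)
    moreover have "Y (n + 2, 1, 1) \<noteq> 0"
      using True by (intro nz) (simp add: Lam_def)
    ultimately have "Y (n, 1, 1) = Y (n + 4, 1, 1)"
      by (simp only: mult_cancel_left) simp
    moreover have "i = 1" "j = 1"
      using site True by (auto simp: Lam_def)
    ultimately show ?thesis
      using True by (simp add: ac_simps)
  next
    case False
    \<comment> \<open>Now every site has a neighbour. A value -1 would annihilate a denominator in
      the equation of a \<open>j\<close>-neighbour, or the right-hand side for an
      \<open>i\<close>-neighbour, whose left-hand side is nonzero.\<close>
    have nm1: "1 + Y (m, p, q) \<noteq> 0" if s: "(m, p, q) \<in> Lam r k" for m p q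
    proof -
      have num: "num_factor r k Y (m, p' - 1, q') \<noteq> 0 \<and> num_factor r k Y (m, p' + 1, q') \<noteq> 0"
        if s': "(m, p', q') \<in> Lam r k" for p' q'
      proof -
        have "Y (m - 1, p', q') \<noteq> 0" "Y (m + 1, p', q') \<noteq> 0"
          using s' by (auto intro!: nz simp: Lam_def)
        then show ?thesis
          using eq[OF s'] den[OF s'] by force
      qed
      have dn: "1 + 1 / Y (m, p, q) \<noteq> 0 \<Longrightarrow> ?thesis"
        using nz[OF s] by (auto simp: field_simps)
      consider "q < k" | "1 < q" | "p < r" | "1 < p"
        using False s by (force simp: Lam_def)
      then show ?thesis
      proof cases
        case 1
        then show ?thesis
          using den(2)[of m p "q + 1"] s dn by (auto simp: Lam_def den_factor_def)
      next
        case 2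
        then show ?thesis
          using den(1)[of m p "q - 1"] s dn by (auto simp: Lam_def den_factor_def)
      next
        case 3
        then show ?thesis
          using num[of "p + 1" q] s by (auto simp: Lam_def num_factor_def)
      next
        case 4
        then show ?thesis
          using num[of "p - 1" q] s by (auto simp: Lam_def num_factor_def)
      qed
    qed
    \<comment> \<open>The offset puts the given site at \<open>a = 0\<close>; only later times are
      then involved.\<close>
    define y where "y = (\<lambda>a p q. Y (n - i - j + 2 * int a + int p + int q, int p, int q))"
    have num': "num_factor r k Y (m, int p, int q) = Y_num (nat r) (nat k) y a p q"
      if "m = n - i - j + 2 * int a + int p + int q" for m a p q
      using assms(1,2) that by (auto simp: num_factor_def Lam_def y_def Y_num_def)
    have den': "den_factor r k Y (m, int p, int q) = Y_den (nat r) (nat k) y a p q"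
      if "m = n - i - j + 2 * int a + int p + int q" for m a p q
      using assms(1,2) that by (auto simp: den_factor_def Lam_def y_def Y_den_def)
    interpret regular_Y_system "nat r" "nat k" y
    proof
      fix a p q :: nat
      assume pq: "1 \<le> p" "p \<le> nat r" "1 \<le> q" "q \<le> nat k"
      show "y a p q \<noteq> 0"
        unfolding y_def using pq by (intro nz) (auto simp: Lam_def)
      show "1 + y a p q \<noteq> 0"
        unfolding y_def using pq by (intro nm1) (auto simp: Lam_def)
    next
      fix a p q :: nat
      assume pq: "Suc p \<le> nat r" "Suc q \<le> nat k"
      \<comment> \<open>The time halfway between indices \<open>a\<close> and \<open>Suc a\<close>
        at the site \<open>(Suc p, Suc q)\<close>.\<close>
      let ?m = "n - i - j + 2 * int a + int p + int q + 3"
      have "(?m, int (Suc p), int (Suc q)) \<in> Lam r k"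
        using pq by (auto simp: Lam_def)
      note eq[OF this]
      moreover have "Y (?m - 1, int (Suc p), int (Suc q)) = y a (Suc p) (Suc q)"
        "Y (?m + 1, int (Suc p), int (Suc q)) = y (Suc a) (Suc p) (Suc q)"
        by (simp_all add: y_def algebra_simps)
      moreover have "num_factor r k Y (?m, int (Suc p) - 1, int (Suc q)) =
          Y_num (nat r) (nat k) y (Suc a) p (Suc q)"
        using num'[of ?m "Suc a" p "Suc q"] by simp
      moreover have "num_factor r k Y (?m, int (Suc p) + 1, int (Suc q)) =
          Y_num (nat r) (nat k) y a (Suc (Suc p)) (Suc q)"
        using num'[of ?m a "Suc (Suc p)" "Suc q"] by (simp add: ac_simps)
      moreover have "den_factor r k Y (?m, int (Suc p), int (Suc q) - 1) =
          Y_den (nat r) (nat k) y (Suc a) (Suc p) q"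
        using den'[of ?m "Suc a" "Suc p" q] by simp
      moreover have "den_factor r k Y (?m, int (Suc p), int (Suc q) + 1) =
          Y_den (nat r) (nat k) y a (Suc p) (Suc (Suc q))"
        using den'[of ?m a "Suc p" "Suc (Suc q)"] by (simp add: ac_simps)
      ultimately show "y a (Suc p) (Suc q) * y (Suc a) (Suc p) (Suc q) *
          (Y_den (nat r) (nat k) y a (Suc p) (Suc (Suc q)) * Y_den (nat r) (nat k) y (Suc a) (Suc p) q) =
          Y_num (nat r) (nat k) y (Suc a) p (Suc q) * Y_num (nat r) (nat k) y a (Suc (Suc p)) (Suc q)"
        by (simp only:)
    qed
    have ij: "1 \<le> nat i" "nat i \<le> nat r" "1 \<le> nat j" "nat j \<le> nat k" "int (nat i) = i" "int (nat j) = j"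
      using site by (auto simp: Lam_def)
    have "y (0 + nat i + nat j) (nat r + 1 - nat i) (nat k + 1 - nat j) = y 0 (nat i) (nat j)"
      using ij by (intro glide_symmetry) auto
    moreover have "int (nat r + 1 - nat i) = r + 1 - i" "int (nat k + 1 - nat j) = k + 1 - j"
      using site by (auto simp: Lam_def)
    ultimately show ?thesis
      using ij by (simp add: y_def algebra_simps)
  qed
qed

end
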